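(* Let $\Delta\subset[0,1]^2$ be the open convex polygon with corners $(0,1),(1/2,1),(1/3,2/3),(0,1/2)$. Then $\Delta$ is a cycle trap for the baker's map.
   Context: Let $X=[0,1]^2$. The baker's map is $B(x,y)=(2x,\frac y2)$ if $0\le x<\frac12$ and $B(x,y)=(2x-1,\frac{y+1}2)$ if $\frac12\le x<1$. For a bi-infinite sequence $u=(x_n)_{n\in\mathbb Z}\in\{0,1\}^{\mathbb Z}$, written $\dots x_{-1}x_0\cdot x_1x_2\dots$, put $\pi(u)=\left(\sum_{n\ge1}x_n2^{-n},\ \sum_{n\ge0}x_{-n}2^{-n-1}\right)$. The map $\pi$ conjugates the left shift $\sigma$ and $B$; points and sequences are used interchangeably, so the $B$-orbit of the point $\pi(u)$ is $(\pi(\sigma^n u))_{n\in\mathbb Z}$. For $H\subset X$ the survivor set is $\mathcal J(H)=\{(x,y)\in X: B^n(x,y)\notin H \text{ for all } n\in\mathbb Z\}$, i.e. $\mathcal J(H)=\{\pi(u): \pi(\sigma^nu)\notin H\ \text{for all } n\in\mathbb Z\}$. An open set $H$ is a cycle trap if $\mathcal J(\overline H)$ does not contain any cycles of $B$, where a cycle is a periodic orbit of $B$ other than the fixed points $(0,0)$ and $(1,1)$. *)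

theory Defs
  imports "HOL-Analysis.Analysis"
begin

definition unit_square :: "(real \<times> real) set" where
  "unit_square = {0..1} \<times> {0..1}"

text \<open>The second branch is also used on the edge \<open>x = 1\<close>, where the usual formula for the
  baker's map is silent. This agrees with the shift on sequences whose positive half is
  constantly one, and makes \<open>(1, 1)\<close> a fixed point.\<close>

definition baker :: "real \<times> real \<Rightarrow> real \<times> real" where
  "baker = (\<lambda>(x, y). if x < 1/2 then (2 * x, y / 2) else (2 * x - 1, (y + 1) / 2))"

text \<open>A bi-infinite 0-1 sequence \<open>\<dots> x\<^sub>-\<^sub>1 x\<^sub>0 \<cdot> x\<^sub>1 x\<^sub>2 \<dots>\<close> is a function
  \<^typ>\<open>int \<Rightarrow> bool\<close>, with \<^const>\<open>True\<close> for the digit 1. The digits right of the dot expand the first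
  coordinate, those left of it (read leftwards) the second.\<close>

definition coding :: "(int \<Rightarrow> bool) \<Rightarrow> real \<times> real" where
  "coding u = ((\<Sum>n. of_bool (u (int n + 1)) / 2 ^ (n + 1)),
               (\<Sum>n. of_bool (u (- int n)) / 2 ^ (n + 1)))"

text \<open>\<open>shift n\<close> is the \<open>n\<close>-th power, for any integer \<open>n\<close>, of the left shift.\<close>

definition shift :: "int \<Rightarrow> (int \<Rightarrow> bool) \<Rightarrow> (int \<Rightarrow> bool)" where
  "shift n u = (\<lambda>m. u (m + n))"

text \<open>The two-sided orbit is taken on the symbolic side, since \<^const>\<open>baker\<close> is not injective:
  the points \<open>(x/2, 1)\<close> and \<open>((x+1)/2, 0)\<close> have the same image.\<close>

definition survivor_set :: "(real \<times> real) set \<Rightarrow> (real \<times> real) set" where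
  "survivor_set H = {coding u | u. \<forall>n. coding (shift n u) \<notin> H}"

definition baker_cycle :: "(real \<times> real) set \<Rightarrow> bool" where
  "baker_cycle C \<longleftrightarrow>
     (\<exists>p \<in> unit_square. \<exists>k > 0. (baker ^^ k) p = p \<and> C = {(baker ^^ n) p | n. True}) \<and>
     C \<noteq> {(0, 0)} \<and> C \<noteq> {(1, 1)}"

definition cycle_trap :: "(real \<times> real) set \<Rightarrow> bool" where
  "cycle_trap H \<longleftrightarrow>
     openin (top_of_set unit_square) H \<and>
     \<not> (\<exists>C. baker_cycle C \<and> C \<subseteq> survivor_set (closure H))"

end

theory Submission
  imports Defs
begin

text \<open>Number the points \<open>(F n, G n)\<close> of a periodic orbit by the integers modulo the period, and let
  \<open>u (n + 1)\<close> be the leading binary digit of \<open>F n\<close>. Avoiding the closed polygon says that at every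
  occurrence of \<open>1\<cdot>0\<close> in \<open>u\<close>, say \<open>u i = 1\<close> and \<open>u (i + 1) = 0\<close>, either \<open>G i < F (i + 1)\<close> or
  \<open>G (i - 1) < F i\<close>. If \<open>11\<close> occurs, consider the end \<open>i\<close> of a longest run of ones, of length \<open>a\<close>.
  Only the first alternative is possible, and it forces the zero at \<open>i + 1\<close> to be followed by
  another run of length \<open>a\<close>; so \<open>u\<close> is the repetition of \<open>1\<^sup>a0\<close>, which is symmetric about \<open>i + 1\<close>,
  and hence \<open>G i = F (i + 1)\<close>, a contradiction. Time reversal combined with exchanging the digits
  excludes \<open>00\<close>, and the alternating sequence is excluded by symmetry again.\<close>

locale periodic_digits =
  fixes u :: "int \<Rightarrow> bool" and F G :: "int \<Rightarrow> real" and k :: int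
  assumes k_pos: "k > 0"
    and periodic: "u (n + k) = u n"
    and F_bounds: "0 \<le> F n" "F n \<le> 1"
    and G_bounds: "0 \<le> G n" "G n \<le> 1"
    and F_rec: "F n = (of_bool (u (n + 1)) + F (n + 1)) / 2"
    and G_rec: "G (n + 1) = (of_bool (u (n + 1)) + G n) / 2"
begin

section \<open>Periodicity, mirror symmetry, and expansions that begin with ones\<close>

lemma G_rec': "G n = (of_bool (u n) + G (n - 1)) / 2"
  using G_rec[of "n - 1"] by simp

lemma periodic_nat_mult: "u (n + int t * k) = u n"
proof (induction t)
  case (Suc t)
  show ?case
    using Suc periodic[of "n + int t * k"] by (simp add: algebra_simps)
qed simp

lemma periodic_mult: "u (n + t * k) = u n"
proof (cases "t \<ge> 0")
  case True
  then show ?thesis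
    using periodic_nat_mult[of n "nat t"] by simp
next
  case False
  then show ?thesis
    using periodic_nat_mult[of "n + t * k" "nat (- t)"] by simp
qed

lemma shift_above: "\<exists>t. m \<le> w + t * k"
proof
  have "m - w \<le> \<bar>m - w\<bar> * 1"
    by simp
  also have "\<dots> \<le> \<bar>m - w\<bar> * k"
    using k_pos by (intro mult_left_mono) auto
  finally show "m \<le> w + \<bar>m - w\<bar> * k"
    by simp
qed

text \<open>\<open>G i\<close> reads the digits from \<open>i\<close> leftwards,
  \<open>F (i + 1)\<close> those from \<open>i + 2\<close> rightwards. These agree by the mirror
  symmetry about \<open>i + 1\<close>, so peeling off \<open>n\<close> digits bounds the difference
  by \<open>(1/2) ^ n\<close>.\<close>

lemma reflect:
  assumes "\<And>n. u (i - int n) = u (i + 2 + int n)"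
  shows "G i = F (i + 1)"
proof -
  have step: "G i - F (i + 1) = (G (i - int n) - F (i + 1 + int n)) / 2 ^ n" for n
  proof (induction n)
    case (Suc n)
    have "u (i + 1 + int n + 1) = u (i - int n)"
      using assms[of n] by (simp add: algebra_simps)
    then have "G (i - int n) - F (i + 1 + int n)
        = (G (i - int (Suc n)) - F (i + 1 + int (Suc n))) / 2"
      using G_rec'[of "i - int n"] F_rec[of "i + 1 + int n"]
      by (simp add: algebra_simps)
    with Suc show ?case by simp
  qed simp
  have bound: "\<bar>G i - F (i + 1)\<bar> \<le> (1/2) ^ n" for n
  proof -
    have "\<bar>G (i - int n) - F (i + 1 + int n)\<bar> \<le> 1"
      using F_bounds[of "i + 1 + int n"] G_bounds[of "i - int n"] by linarith
    then show ?thesis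
      unfolding step[of n] by (simp add: abs_divide power_one_over divide_simps)
  qed
  have "\<bar>G i - F (i + 1)\<bar> \<le> 0"
    by (rule LIMSEQ_le_const[OF LIMSEQ_realpow_zero[of "1/2"]]) (use bound in auto)
  then show ?thesis by simp
qed

lemma G_run:
  assumes "\<And>j. j < a \<Longrightarrow> u (i - int j)"
  shows "G i \<ge> 1 - 1 / 2 ^ a"
  using assms
proof (induction a arbitrary: i)
  case 0
  then show ?case using G_bounds[of i] by simp
next
  case (Suc a)
  have "u ((i - 1) - int j)" if "j < a" for j
    using Suc.prems[of "Suc j"] that by (simp add: algebra_simps)
  then have "G (i - 1) \<ge> 1 - 1 / 2 ^ a"
    by (rule Suc.IH)
  moreover have "u i"
    using Suc.prems[of 0] by simp
  ultimately show ?case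
    using G_rec'[of i] by simp
qed

text \<open>Strictness matters: for \<open>a > 0\<close> the value \<open>1 - 1 / 2 ^ a\<close> also
  has the expansion with \<open>a - 1\<close> ones, a zero, and then only ones.\<close>

lemma F_run:
  assumes "F i > 1 - 1 / 2 ^ a" "j < a"
  shows "u (i + 1 + int j)"
  using assms
proof (induction a arbitrary: i j)
  case (Suc a)
  have "(1 :: real) / 2 ^ Suc a \<le> 1 / 2"
    by (simp add: divide_simps)
  then have "F i > 1 / 2"
    using Suc.prems(1) by linarith
  then have u: "u (i + 1)"
    using F_rec[of i] F_bounds[of "i + 1"] by (cases "u (i + 1)") auto
  then have F: "F (i + 1) > 1 - 1 / 2 ^ a"
    using Suc.prems(1) F_rec[of i] by simp
  show ?case
  proof (cases j)
    case 0
    then show ?thesis using u by simp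
  next
    case (Suc j')
    then show ?thesis
      using Suc.IH[OF F, of j'] Suc.prems(2) by (simp add: algebra_simps)
  qed
qed simp

section \<open>Runs of ones\<close>

text \<open>Only the right end is pinned down, so \<open>a\<close> is a lower bound for the length
  of the block; maximality is expressed by excluding \<open>run (Suc a)\<close>.\<close>

definition run :: "nat \<Rightarrow> int \<Rightarrow> bool" where
  "run a i \<longleftrightarrow> \<not> u (i + 1) \<and> (\<forall>j<a. u (i - int j))"

lemma run_periodic: "run a (i + t * k) = run a i"
proof -
  have "u (i + t * k + 1) = u (i + 1)"
    using periodic_mult[of "i + 1" t] by (simp add: algebra_simps)
  moreover have "u (i + t * k - int j) = u (i - int j)" for j
    using periodic_mult[of "i - int j" t] by (simp add: algebra_simps)
  ultimately show ?thesis
    by (simp add: run_def)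
qed

text \<open>Some translate of the zero at \<open>w\<close> by a multiple of the period lies to the
  right of \<open>m\<close>; the first zero from \<open>m\<close> on comes after the given
  ones.\<close>

lemma run_exists:
  assumes "\<And>j. j < a \<Longrightarrow> u (m + int j)" "\<not> u w"
  shows "\<exists>i. run a i"
proof -
  obtain t where t: "m \<le> w + t * k"
    using shift_above by blast
  define P where "P = (\<lambda>n. \<not> u (m + int n))"
  have "P (nat (w + t * k - m))"
    using t assms(2) periodic_mult[of w t] by (simp add: P_def)
  define z where "z = (LEAST n. P n)"
  have z: "P z"
    unfolding z_def by (rule LeastI) fact
  have below: "u (m + int n)" if "n < z" for n
    using not_less_Least[of n P] that by (auto simp: z_def P_def)
  have "a \<le> z"
    using z assms(1)[of z] by (force simp: P_def)
  have "u (m + int z - 1 - int j)" if "j < a" for j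
  proof -
    have "z - 1 - j < z" "int (z - 1 - j) = int z - 1 - int j"
      using that \<open>a \<le> z\<close> by auto
    moreover from this have "m + int z - 1 - int j = m + int (z - 1 - j)"
      by linarith
    ultimately show ?thesis using below by metis
  qed
  then have "run a (m + int z - 1)"
    using z by (simp add: run_def P_def)
  then show ?thesis by blast
qed

text \<open>A run of \<open>k\<close> ones ending at \<open>i\<close> would contain
  \<open>i + 1 - k\<close>, whose digit equals the zero at \<open>i + 1\<close>.\<close>

lemma run_bound:
  assumes "run a i"
  shows "a < nat k"
proof (rule ccontr)
  assume "\<not> a < nat k"
  then have "nat (k - 1) < a"
    using k_pos by linarith
  then have "u (i - int (nat (k - 1)))"
    using assms unfolding run_def by blast
  moreover have "i - int (nat (k - 1)) = i + 1 - k"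
    using k_pos by simp
  ultimately have "u (i + 1)"
    using periodic[of "i + 1 - k"] by (metis diff_add_cancel)
  then show False
    using assms by (simp add: run_def)
qed

lemma no_longest_run:
  assumes run: "run a i0"
    and maximal: "\<And>i. \<not> run (Suc a) i"
    and less: "\<And>i. run a i \<Longrightarrow> G i < F (i + 1)"
  shows False
proof -
  have next_run: "run a (i + (int a + 1))" if "run a i" for i
  proof -
    have "1 - 1 / 2 ^ a \<le> G i"
      using that by (intro G_run) (simp add: run_def)
    then have F: "F (i + 1) > 1 - 1 / 2 ^ a"
      using less[OF that] by linarith
    have ones: "u (i + 2 + int j)" if "j < a" for j
      using F_run[OF F that] by (simp add: algebra_simps)
    \<comment> \<open>A further one would give \<open>a + 1\<close> consecutive ones, and periodic
      copies of the zero at \<open>i + 1\<close> would turn them into a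
      \<open>run (Suc a)\<close>.\<close>
    have zero: "\<not> u (i + 2 + int a)"
    proof
      assume "u (i + 2 + int a)"
      with ones have "u (i + 2 + int j)" if "j < Suc a" for j
        using that by (auto simp: less_Suc_eq)
      moreover have "\<not> u (i + 1)"
        using \<open>run a i\<close> by (simp add: run_def)
      ultimately show False
        using run_exists maximal by blast
    qed
    have "u (i + (int a + 1) - int j)" if "j < a" for j
    proof -
      have "i + (int a + 1) - int j = i + 2 + int (a - 1 - j)" "a - 1 - j < a"
        using that by auto
      then show ?thesis using ones by metis
    qed
    with zero show ?thesis
      by (simp add: run_def algebra_simps)
  qed
  have runs_nat: "run a (i0 + int n * (int a + 1))" for n
  proof (induction n)
    case (Suc n)
    have "i0 + int (Suc n) * (int a + 1) = i0 + int n * (int a + 1) + (int a + 1)"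
      by (simp add: algebra_simps)
    then show ?case using next_run[OF Suc] by metis
  qed (simp add: run)
  have runs: "run a (i0 + n * (int a + 1))" for n
  proof -
    \<comment> \<open>For negative \<open>n\<close>, adding a multiple of \<open>k\<close> makes the
      index nonnegative and moves the position by a multiple of the period.\<close>
    obtain t where t: "0 \<le> n + t * k"
      using shift_above by blast
    have "i0 + (n + t * k) * (int a + 1) = i0 + n * (int a + 1) + t * (int a + 1) * k"
      by (simp add: algebra_simps)
    moreover have "run a (i0 + (n + t * k) * (int a + 1))"
      using runs_nat[of "nat (n + t * k)"] t by simp
    ultimately show ?thesis
      using run_periodic by metis
  qed
  \<comment> \<open>Remainder \<open>r = 0\<close> is the zero closing run number \<open>q\<close>;
    any other remainder lies inside run \<open>q + 1\<close>, at distance \<open>a - r\<close> from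
    its end.\<close>
  have digits: "u m \<longleftrightarrow> \<not> (int a + 1) dvd m - (i0 + 1)" for m
  proof -
    define q where "q = (m - (i0 + 1)) div (int a + 1)"
    define r where "r = (m - (i0 + 1)) mod (int a + 1)"
    have m: "m = i0 + 1 + q * (int a + 1) + r"
      unfolding q_def r_def using div_mult_mod_eq[of "m - (i0 + 1)" "int a + 1"] by linarith
    have r: "0 \<le> r" "r < int a + 1"
      unfolding r_def by (intro pos_mod_sign pos_mod_bound; simp)+
    show ?thesis
    proof (cases "r = 0")
      case True
      then have "\<not> u m"
        using runs[of q] m by (simp add: run_def algebra_simps)
      with True show ?thesis
        by (simp add: r_def dvd_eq_mod_eq_0)
    next
      case False
      then have j: "nat (int a - r) < a" "int (nat (int a - r)) = int a - r"
        using r by auto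
      then have "u (i0 + (q + 1) * (int a + 1) - int (nat (int a - r)))"
        using runs[of "q + 1"] unfolding run_def by blast
      moreover have "i0 + (q + 1) * (int a + 1) - (int a - r) = m"
        unfolding m by (simp add: algebra_simps)
      ultimately have "u m"
        by (simp only: j(2))
      with False show ?thesis
        by (simp add: r_def dvd_eq_mod_eq_0)
    qed
  qed
  have "u (i0 - int n) = u (i0 + 2 + int n)" for n
  proof -
    have "i0 - int n - (i0 + 1) = - (i0 + 2 + int n - (i0 + 1))"
      by simp
    then show ?thesis
      unfolding digits by (metis dvd_minus_iff)
  qed
  then have "G i0 = F (i0 + 1)"
    by (rule reflect)
  with less[OF run] show False by simp
qed

lemma no_double_one:
  assumes avoid: "\<And>i. u i \<Longrightarrow> \<not> u (i + 1) \<Longrightarrow> G i < F (i + 1) \<or> G (i - 1) < F i"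
    and "u m" "u (m + 1)" "\<not> u w"
  shows False
proof -
  have "u (m + int j)" if "j < 2" for j
    using that assms(2,3) by (auto simp: less_2_cases_iff)
  then have ex2: "\<exists>i. run 2 i"
    using \<open>\<not> u w\<close> by (rule run_exists)
  define a where "a = (GREATEST a. \<exists>i. run a i)"
  have bounded: "\<exists>i. run a' i \<Longrightarrow> a' \<le> nat k" for a'
    using run_bound by force
  have "\<exists>i. run a i"
    unfolding a_def by (rule GreatestI_nat[where P = "\<lambda>a. \<exists>i. run a i", OF ex2 bounded])
  then obtain i0 where i0: "run a i0" ..
  have greatest: "a' \<le> a" if "run a' i" for a' i
    unfolding a_def using that bounded
    by (intro Greatest_le_nat[where P = "\<lambda>a. \<exists>i. run a i"]) auto
  have "2 \<le> a"
    using ex2 greatest by blast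
  show False
  proof (rule no_longest_run[OF i0])
    show "\<not> run (Suc a) i" for i
      using greatest[of "Suc a" i] by auto
  next
    fix i
    assume "run a i"
    then have ones: "u (i - int j)" if "j < a" for j
      using that by (simp add: run_def)
    have "u i" "u (i - 1)"
      using ones[of 0] ones[of 1] \<open>2 \<le> a\<close> by auto
    have "\<not> u (i + 1)"
      using \<open>run a i\<close> by (simp add: run_def)
    \<comment> \<open>The digit 1 at \<open>i - 1\<close> and the digit 0 at \<open>i + 1\<close>
      put 1/2 between the two sides, which rules out the second alternative of
      \<open>avoid\<close>.\<close>
    have "F i \<le> G (i - 1)"
      using G_rec'[of "i - 1"] F_rec[of i] \<open>u (i - 1)\<close> \<open>\<not> u (i + 1)\<close>
        F_bounds[of "i + 1"] G_bounds[of "i - 1 - 1"] by simp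
    then show "G i < F (i + 1)"
      using avoid[of i] \<open>u i\<close> \<open>\<not> u (i + 1)\<close> by auto
  qed
qed

text \<open>On points this is \<open>(x, y)\<close> to \<open>(1 - y, 1 - x)\<close>, the reflection
  in the line \<open>x + y = 1\<close>. The offset in \<open>1 - m\<close> arises because
  \<open>G n\<close> starts with digit \<open>n\<close> but \<open>F n\<close> with digit
  \<open>n + 1\<close>.\<close>

lemma time_reversal:
  "periodic_digits (\<lambda>m. \<not> u (1 - m)) (\<lambda>i. 1 - G (- i)) (\<lambda>i. 1 - F (- i)) k"
proof
  fix n
  show "(\<not> u (1 - (n + k))) = (\<not> u (1 - n))"
    using periodic[of "1 - (n + k)"] by simp
  show "1 - G (- n) = (of_bool (\<not> u (1 - (n + 1))) + (1 - G (- (n + 1)))) / 2"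
    using G_rec[of "- (n + 1)"] by (cases "u (- n)") simp_all
  show "1 - F (- (n + 1)) = (of_bool (\<not> u (1 - (n + 1))) + (1 - F (- n))) / 2"
    using F_rec[of "- (n + 1)"] by (cases "u (- n)") simp_all
qed (use k_pos F_bounds G_bounds in auto)

theorem digits_constant:
  assumes avoid: "\<And>i. u i \<Longrightarrow> \<not> u (i + 1) \<Longrightarrow> G i < F (i + 1) \<or> G (i - 1) < F i"
  shows "(\<forall>n. u n) \<or> (\<forall>n. \<not> u n)"
proof (rule ccontr)
  assume "\<not> ?thesis"
  then obtain v w where v: "u v" and w: "\<not> u w" by auto
  have no11: "\<not> (u m \<and> u (m + 1))" for m
    using no_double_one[OF avoid] w by blast
  interpret rev: periodic_digits "\<lambda>m. \<not> u (1 - m)" "\<lambda>i. 1 - G (- i)" "\<lambda>i. 1 - F (- i)" k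
    by (rule time_reversal)
  \<comment> \<open>Reversal interchanges the two alternatives of \<open>avoid\<close>.\<close>
  have rev_avoid: "1 - F (- i) < 1 - G (- (i + 1)) \<or> 1 - F (- (i - 1)) < 1 - G (- i)"
    if "\<not> u (1 - i)" "\<not> \<not> u (1 - (i + 1))" for i
  proof -
    have "- i + 1 = 1 - i" "- i + 1 = - (i - 1)" "- i - 1 = - (i + 1)" "- i = 1 - (i + 1)"
      by simp_all
    then have "G (- i) < F (- (i - 1)) \<or> G (- (i + 1)) < F (- i)"
      using avoid[of "- i"] that by metis
    then show ?thesis by argo
  qed
  have no00: "u m \<or> u (m + 1)" for m
    using rev.no_double_one[OF rev_avoid, of "- m" "1 - v"] v by (auto simp: algebra_simps)
  have alt: "u (m + 1) \<longleftrightarrow> \<not> u m" for m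
    using no11 no00 by blast
  have "u (m + 2 * int n) = u m" for m n
  proof (induction n)
    case (Suc n)
    show ?case
      using Suc alt[of "m + 2 * int n"] alt[of "m + 2 * int n + 1"] by (simp add: algebra_simps)
  qed simp
  \<comment> \<open>A sequence of period 2 is symmetric about every position, so both alternatives
    at \<open>v\<close> turn into equalities.\<close>
  from this[of "i - int n" "Suc n" for i n]
  have sym: "u (i - int n) = u (i + 2 + int n)" for i n
    by (simp add: algebra_simps)
  have "G v = F (v + 1)" "G (v - 1) = F v"
    using reflect[OF sym, of v] reflect[OF sym, of "v - 1"] by auto
  then show False
    using avoid[OF v] alt[of v] v by simp
qed

text \<open>Serves both fixed points: \<open>(0, 0)\<close> directly, \<open>(1, 1)\<close> through
  \<open>time_reversal\<close>.\<close>

lemma zero_if_digits_zero: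
  assumes "\<And>n. \<not> u n"
  shows "F n = 0" "G n = 0"
proof -
  have "F n = F (n + int j) / 2 ^ j" for j
  proof (induction j)
    case (Suc j)
    then show ?case
      using F_rec[of "n + int j"] assms by (simp add: algebra_simps)
  qed simp
  then have F: "F n \<le> (1/2) ^ j" for j
    using F_bounds(2)[of "n + int j"] by (metis divide_right_mono power_one_over zero_le_numeral zero_le_power)
  have "G n = G (n - int j) / 2 ^ j" for j
  proof (induction j)
    case (Suc j)
    then show ?case
      using G_rec'[of "n - int j"] assms by (simp add: algebra_simps)
  qed simp
  then have G: "G n \<le> (1/2) ^ j" for j
    using G_bounds(2)[of "n - int j"] by (metis divide_right_mono power_one_over zero_le_numeral zero_le_power)
  have "F n \<le> 0" "G n \<le> 0"
    by (rule LIMSEQ_le_const[OF LIMSEQ_realpow_zero[of "1/2"]]; use F G in auto)+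
  then show "F n = 0" "G n = 0"
    using F_bounds[of n] G_bounds[of n] by auto
qed

end

section \<open>Geometry of the polygon\<close>

abbreviation (input) trap_polygon :: "(real \<times> real) set" where
  "trap_polygon \<equiv> convex hull {(0, 1), (1/2, 1), (1/3, 2/3), (0, 1/2)}"

text \<open>The diagonal \<open>x + y = 1\<close> cuts the polygon into two triangles; the coefficients below are the
  barycentric coordinates in these.\<close>

lemma trap_polygon_memI:
  fixes x y :: real
  assumes "0 \<le> x" "y \<le> 1" "2 * x \<le> y" "1 + x \<le> 2 * y"
  shows "(x, y) \<in> trap_polygon"
proof (cases "x + y \<ge> 1")
  case True
  have "(x, y) = (y - 2 * x) *\<^sub>R (0, 1) + (2 * (x + y - 1)) *\<^sub>R (1/2, 1) + (3 * (1 - y)) *\<^sub>R (1/3, 2/3)"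
    by (simp add: algebra_simps)
  then have "(x, y) \<in> convex hull {(0, 1), (1/2, 1), (1/3, 2/3)}"
    unfolding convex_hull_3 using assms True
    by (intro CollectI exI[of _ "y - 2 * x"] exI[of _ "2 * (x + y - 1)"] exI[of _ "3 * (1 - y)"]) auto
  then show ?thesis
    by (rule rev_subsetD) (intro hull_mono, auto)
next
  case False
  have "(x, y) = (2 * y - 1 - x) *\<^sub>R (0, 1) + (3 * x) *\<^sub>R (1/3, 2/3) + (2 * (1 - x - y)) *\<^sub>R (0, 1/2)"
    by (simp add: algebra_simps)
  then have "(x, y) \<in> convex hull {(0, 1), (1/3, 2/3), (0, 1/2)}"
    unfolding convex_hull_3 using assms False
    by (intro CollectI exI[of _ "2 * y - 1 - x"] exI[of _ "3 * x"] exI[of _ "2 * (1 - x - y)"]) auto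
  then show ?thesis
    by (rule rev_subsetD) (intro hull_mono, auto)
qed

lemma trap_polygon_subset: "trap_polygon \<subseteq> unit_square"
proof (rule hull_minimal)
  show "convex unit_square"
    unfolding unit_square_def by (intro convex_Times) auto
qed (auto simp: unit_square_def)

text \<open>A compact convex set with interior points is the closure of its interior; a small open
  box inside the polygon supplies such points.\<close>

lemma closure_interior_trap_polygon: "closure (interior trap_polygon) = trap_polygon"
proof -
  have "{1/10<..<2/10} \<times> {8/10<..<9/10} \<subseteq> trap_polygon"
    by (auto intro!: trap_polygon_memI)
  then have "{1/10<..<2/10} \<times> {8/10<..<9/10} \<subseteq> interior trap_polygon"
    by (intro interior_maximal open_Times) auto
  moreover have "(3/20, 17/20) \<in> {1/10<..<2/10 :: real} \<times> {8/10<..<9/10 :: real}"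
    by simp
  ultimately have "interior trap_polygon \<noteq> {}"
    by blast
  then have "closure (interior trap_polygon) = closure trap_polygon"
    by (intro convex_closure_interior) auto
  also have "\<dots> = trap_polygon"
    by (intro closure_closed compact_imp_closed compact_convex_hull finite_imp_compact) auto
  finally show ?thesis .
qed

section \<open>From periodic points of the baker's map to digits\<close>

lemma baker_in_unit_square: "p \<in> unit_square \<Longrightarrow> baker p \<in> unit_square"
  by (cases p) (auto simp: baker_def unit_square_def)

lemma periodic_point_meets_trap:
  assumes p: "p \<in> unit_square" and "k > 0" and per: "(baker ^^ k) p = p"
    and avoid: "\<And>n. (baker ^^ n) p \<notin> trap_polygon"
  shows "p = (0, 0) \<or> p = (1, 1)"
proof -
  \<comment> \<open>Since \<open>baker\<close> is not injective, the backward orbit is read off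
    around the cycle, with indices reduced modulo the period.\<close>
  define P where "P = (\<lambda>n. (baker ^^ nat (n mod int k)) p)"
  define F where "F = (\<lambda>n. fst (P n))"
  define G where "G = (\<lambda>n. snd (P n))"
  \<comment> \<open>Digit \<open>n + 1\<close> records the branch that \<open>baker\<close> takes at
    \<open>P n\<close>, with the tie at 1/2 resolved as there.\<close>
  define u where "u = (\<lambda>n. F (n - 1) \<ge> 1/2)"
  have P_Suc: "P (n + 1) = baker (P n)" for n
  proof -
    have "(n + 1) mod int k = int (Suc (nat (n mod int k)) mod k)"
      using \<open>k > 0\<close> by (simp add: zmod_int mod_simps add.commute)
    then have "P (n + 1) = (baker ^^ (Suc (nat (n mod int k)) mod k)) p"
      by (simp add: P_def)
    also have "\<dots> = (baker ^^ Suc (nat (n mod int k))) p"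
      by (rule funpow_mod_eq[OF per])
    finally show ?thesis by (simp add: P_def)
  qed
  have P_square: "P n \<in> unit_square" for n
  proof -
    have "(baker ^^ m) p \<in> unit_square" for m
      by (induction m) (auto simp: p baker_in_unit_square)
    then show ?thesis by (simp add: P_def)
  qed
  have P_avoid: "(F n, G n) \<notin> trap_polygon" for n
    using avoid by (simp add: F_def G_def P_def)
  have P_eq: "P n = (F n, G n)" for n
    by (simp add: F_def G_def)
  have rec: "(F (n + 1), G (n + 1)) = baker (F n, G n)" for n
    using P_Suc by (simp add: P_eq)
  interpret orbit: periodic_digits u F G "int k"
  proof
    fix n
    show "u (n + int k) = u n"
      using mod_add_self2[of "n - 1" "int k"]
      by (simp add: u_def F_def P_def diff_add_eq del: mod_add_self1 mod_add_self2)
    show "0 \<le> F n" "F n \<le> 1" "0 \<le> G n" "G n \<le> 1"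
      using P_square[of n] by (auto simp: P_eq unit_square_def)
    show "F n = (of_bool (u (n + 1)) + F (n + 1)) / 2"
      "G (n + 1) = (of_bool (u (n + 1)) + G n) / 2"
      using rec[of n] by (auto simp: u_def baker_def split: if_splits)
  qed (use \<open>k > 0\<close> in auto)
  \<comment> \<open>At such \<open>i\<close> the edges on \<open>y = 2 * x\<close> and
    \<open>2 * y = 1 + x\<close> become comparisons of \<open>G i\<close> with
    \<open>F (i + 1)\<close> and of \<open>G (i - 1)\<close> with \<open>F i\<close>.\<close>
  have "G i < F (i + 1) \<or> G (i - 1) < F i" if "u i" "\<not> u (i + 1)" for i
  proof -
    have "2 * F i = F (i + 1)" "2 * G i = 1 + G (i - 1)"
      using orbit.F_rec[of i] orbit.G_rec'[of i] that by simp_all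
    moreover have "\<not> (2 * F i \<le> G i \<and> 1 + F i \<le> 2 * G i)"
      using P_avoid[of i] trap_polygon_memI[of "F i" "G i"]
        orbit.F_bounds(1)[of i] orbit.G_bounds(2)[of i] by blast
    ultimately show ?thesis by linarith
  qed
  then consider "\<forall>n. u n" | "\<forall>n. \<not> u n"
    using orbit.digits_constant by blast
  then show ?thesis
  proof cases
    case 1
    interpret rev: periodic_digits "\<lambda>m. \<not> u (1 - m)" "\<lambda>i. 1 - G (- i)" "\<lambda>i. 1 - F (- i)" "int k"
      by (rule orbit.time_reversal)
    have "F 0 = 1" "G 0 = 1"
      using rev.zero_if_digits_zero[of 0] 1 by auto
    then show ?thesis
      using P_eq[of 0] by (simp add: P_def)
  next
    case 2
    then show ?thesis
      using orbit.zero_if_digits_zero[of 0] P_eq[of 0] by (simp add: P_def)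
  qed
qed

theorem corollary3p3:
  "cycle_trap (interior (convex hull {(0, 1), (1/2, 1), (1/3, 2/3), (0, 1/2)}))"
  unfolding cycle_trap_def closure_interior_trap_polygon
proof (intro conjI notI)
  show "openin (top_of_set unit_square) (interior trap_polygon)"
    using trap_polygon_subset interior_subset[of trap_polygon]
    by (intro open_subset) auto
next
  assume "\<exists>C. baker_cycle C \<and> C \<subseteq> survivor_set trap_polygon"
  then obtain C p k where sub: "C \<subseteq> survivor_set trap_polygon"
    and p: "p \<in> unit_square" "k > 0" "(baker ^^ k) p = p"
    and C: "C = {(baker ^^ n) p | n. True}" "C \<noteq> {(0, 0)}" "C \<noteq> {(1, 1)}"
    unfolding baker_cycle_def by blast
  \<comment> \<open>The shift by 0 already keeps the surviving point itself out of
    \<open>H\<close>.\<close>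
  have survivor: "survivor_set H \<inter> H = {}" for H
  proof -
    have "coding u \<notin> H" if "\<forall>n. coding (shift n u) \<notin> H" for u
      using that[rule_format, of 0] by (simp add: shift_def)
    then show ?thesis by (auto simp: survivor_set_def)
  qed
  have "(baker ^^ n) p \<notin> trap_polygon" for n
    using sub survivor[of trap_polygon] C(1) by blast
  with p consider "p = (0, 0)" | "p = (1, 1)"
    using periodic_point_meets_trap by blast
  then show False
  proof cases
    case 1
    have "(baker ^^ n) p = (0, 0)" for n
      by (induction n) (auto simp: 1 baker_def)
    with C show False by auto
  next
    case 2
    have "(baker ^^ n) p = (1, 1)" for n
      by (induction n) (auto simp: 2 baker_def)
    with C show False by auto
  qed
qed

end
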